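(* For $m,n,l\in\mathbb{N}_0$ and $\lambda\in\mathbb{C}$, $$Z_{n}^{(l)}(m;\lambda)=2^{-l}\sum_{j=0}^{l}\binom{l}{j}\frac{(-1)^{j(m+1)}\lambda^{mj+l}}{(n+1)_{l}}\sum_{k=0}^{n+l}\binom{n+l}{k}G_{k}^{(j)}(mj+l;\lambda)\,G_{n+l-k}^{(l-j)}(\lambda),$$ where $(n)_{0}=1$ and $(n)_{k}=n(n+1)\cdots(n+k-1)$.
   Context: Apostol-Genocchi polynomials of order $\alpha$: $\Big(\frac{2z}{\lambda e^{z}+1}\Big)^{\alpha}e^{xz}=\sum_{n\ge0}G_{n}^{(\alpha)}(x;\lambda)\frac{z^{n}}{n!}$, and $G_n^{(\alpha)}(\lambda):=G_n^{(\alpha)}(0;\lambda)$. The multiple alternating sums are, for $m,k,l\in\mathbb{N}_0$, $\lambda\in\mathbb{C}$: $$Z_{k}^{(l)}(m;\lambda)=(-1)^{l}\sum_{\substack{v_1,\dots,v_m\ge 0\\ v_{1}+\dots+v_{m}=l}}\frac{l!}{v_1!\cdots v_m!}(-\lambda)^{v_{1}+2v_{2}+\dots+mv_{m}}(v_{1}+2v_{2}+\dots+mv_{m})^{k},$$ with the convention $0^0=1$. *)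

theory Defs
  imports
    "HOL-Computational_Algebra.Computational_Algebra"
    "HOL-Library.FuncSet"
begin

text \<open>
  The power series expansion of \<open>2z / (lam e^z + 1)\<close> at \<open>z = 0\<close>. For \<open>lam = -1\<close> the denominator vanishes
  at \<open>0\<close>, but only to first order, so the division of formal power series is exact for every \<open>lam\<close>;
  see \<open>apostol_genocchi_base_mult\<close>.
\<close>

definition apostol_genocchi_base :: "complex \<Rightarrow> complex fps" where
  "apostol_genocchi_base lam = (fps_const 2 * fps_X) / (fps_const lam * fps_exp 1 + 1)"

lemma apostol_genocchi_base_mult:
  "apostol_genocchi_base lam * (fps_const lam * fps_exp 1 + 1) = fps_const 2 * fps_X"
proof -
  let ?D = "fps_const lam * fps_exp 1 + 1 :: complex fps"
  have n0: "fps_nth ?D 0 = lam + 1" and n1: "fps_nth ?D 1 = lam"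
    by simp_all
  have nz: "?D \<noteq> 0"
  proof
    assume "?D = 0"
    hence "fps_nth ?D 0 = 0" "fps_nth ?D 1 = 0"
      by (simp_all only: fps_zero_nth)
    thus False using n0 n1 by simp
  qed
  have "subdegree ?D \<le> 1"
  proof (cases "lam = 0")
    case False
    thus ?thesis using n1 by (intro subdegree_leI) simp
  qed simp
  moreover have "subdegree (fps_const 2 * fps_X :: complex fps) = 1"
    by (intro subdegreeI) simp_all
  ultimately have "?D dvd fps_const 2 * fps_X"
    using nz by (simp add: fps_dvd_iff)
  thus ?thesis
    unfolding apostol_genocchi_base_def by simp
qed

text \<open>
  The Apostol-Genocchi polynomial \<open>G_n^(\<alpha>)(x; lam)\<close>, where
  \<open>(2z / (lam e^z + 1))^\<alpha> e^(xz) = (\<Sum>n. G_n^(\<alpha>)(x; lam) z^n / n!)\<close>. The order \<open>\<alpha>\<close> is a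
  natural number: for other orders the left-hand side is in general not a power series in \<open>z\<close>.
\<close>

definition apostol_genocchi_poly :: "nat \<Rightarrow> nat \<Rightarrow> complex \<Rightarrow> complex \<Rightarrow> complex" where
  "apostol_genocchi_poly n \<alpha> x lam =
     fact n * fps_nth (apostol_genocchi_base lam ^ \<alpha> * fps_exp x) n"

definition apostol_genocchi_number :: "nat \<Rightarrow> nat \<Rightarrow> complex \<Rightarrow> complex" where
  "apostol_genocchi_number n \<alpha> lam = apostol_genocchi_poly n \<alpha> 0 lam"

text \<open>
  The tuples \<open>(v\<^sub>1, \<dots>, v\<^sub>m)\<close> of natural numbers with sum \<open>l\<close>, encoded as functions that are
  \<open>undefined\<close> outside \<open>{1..m}\<close>, so that each tuple is counted once.
\<close>

definition weak_compositions :: "nat \<Rightarrow> nat \<Rightarrow> (nat \<Rightarrow> nat) set" where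
  "weak_compositions m l = {v \<in> {1..m} \<rightarrow>\<^sub>E UNIV. (\<Sum>i=1..m. v i) = l}"

lemma finite_weak_compositions: "finite (weak_compositions m l)"
proof (rule finite_subset)
  show "weak_compositions m l \<subseteq> {1..m} \<rightarrow>\<^sub>E {..l}"
  proof
    fix v assume "v \<in> weak_compositions m l"
    hence v: "v \<in> {1..m} \<rightarrow>\<^sub>E UNIV" "(\<Sum>i=1..m. v i) = l"
      by (auto simp: weak_compositions_def)
    have "v i \<le> l" if "i \<in> {1..m}" for i
      using member_le_sum[of i "{1..m}" v] that v(2) by simp
    with v(1) show "v \<in> {1..m} \<rightarrow>\<^sub>E {..l}"
      by (auto simp: PiE_iff)
  qed
qed (auto intro: finite_PiE)

definition multiple_alternating_sum :: "nat \<Rightarrow> nat \<Rightarrow> nat \<Rightarrow> complex \<Rightarrow> complex" where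
  "multiple_alternating_sum k l m lam =
     (-1) ^ l * (\<Sum>v\<in>weak_compositions m l.
       fact l / (\<Prod>i=1..m. fact (v i))
         * (- lam) ^ (\<Sum>i=1..m. i * v i) * of_nat (\<Sum>i=1..m. i * v i) ^ k)"

end

theory Submission
  imports Defs
begin

text \<open>
  Put \<open>q = - lam e\<^sup>z\<close>. By the multinomial theorem, the exponential generating function of
  \<open>n \<mapsto> Z_n^(l)(m; lam)\<close> is \<open>(-1)^l (q + \<dots> + q^m)^l\<close>. Multiplying it by
  \<open>(2z)^l = B^l (1 - q)^l\<close> with \<open>B = 2z / (lam e\<^sup>z + 1)\<close> and telescoping the geometric
  sum turns it into \<open>B^l (-q)^l (1 - q^m)^l\<close>. Expanding the last factor by the binomial theorem,
  distributing \<open>B^l = B^j B^(l - j)\<close> and comparing coefficients of \<open>z^(n + l)\<close> gives the claim.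
  No division by \<open>1 - q\<close> occurs, so \<open>lam = -1\<close> needs no separate treatment.
\<close>

text \<open>Splitting off the last entry \<open>k\<close> drives the induction on \<open>m\<close>
  in \<open>multinomial_fps\<close>. The inverse resets position \<open>Suc m\<close> to
  \<open>undefined\<close>, as the encoding demands of the shorter tuple.\<close>

lemma bij_betw_weak_compositions_Suc:
  "bij_betw (\<lambda>(k, v). v(Suc m := k)) (SIGMA k:{..l}. weak_compositions m (l - k))
     (weak_compositions (Suc m) l)"
proof (rule bij_betw_byWitness[where f' = "\<lambda>v. (v (Suc m), v(Suc m := undefined))"])
  show "\<forall>a\<in>SIGMA k:{..l}. weak_compositions m (l - k).
      (\<lambda>v. (v (Suc m), v(Suc m := undefined))) ((\<lambda>(k, v). v(Suc m := k)) a) = a"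
    by (auto simp: weak_compositions_def PiE_def extensional_def fun_eq_iff)
  show "\<forall>v\<in>weak_compositions (Suc m) l.
      (\<lambda>(k, v). v(Suc m := k)) (v (Suc m), v(Suc m := undefined)) = v"
    by auto
  have upd: "(\<Sum>i=1..m. (v(Suc m := x)) i) = (\<Sum>i=1..m. v i)" for v :: "nat \<Rightarrow> nat" and x
    by (rule sum.cong) auto
  show "(\<lambda>(k, v). v(Suc m := k)) ` (SIGMA k:{..l}. weak_compositions m (l - k))
      \<subseteq> weak_compositions (Suc m) l"
    using upd by (auto simp: weak_compositions_def PiE_def extensional_def simp del: fun_upd_apply)
      simp_all
  show "(\<lambda>v. (v (Suc m), v(Suc m := undefined))) ` weak_compositions (Suc m) l
      \<subseteq> (SIGMA k:{..l}. weak_compositions m (l - k))"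
    using upd by (auto simp: weak_compositions_def PiE_def extensional_def simp del: fun_upd_apply)
      auto
qed

text \<open>Induction on \<open>m\<close>: the binomial theorem separates \<open>f (Suc m)\<close>,
  and the factor \<open>(l - k)!\<close> in \<open>l choose k = l! / (k! (l - k)!)\<close> cancels
  against the multinomial coefficient of the shorter tuple.\<close>

lemma multinomial_fps:
  fixes f :: "nat \<Rightarrow> 'a :: field_char_0 fps"
  shows "(\<Sum>i=1..m. f i) ^ l =
    (\<Sum>v\<in>weak_compositions m l.
      fps_const (fact l / (\<Prod>i=1..m. fact (v i))) * (\<Prod>i=1..m. f i ^ v i))"
proof (induction m arbitrary: l)
  case 0
  \<comment> \<open>The empty tuple has sum 0, so the right-hand side is 1 or 0 exactly as
    \<open>0 ^ l\<close> is.\<close>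
  have "weak_compositions 0 l = (if l = 0 then {\<lambda>_. undefined} else {})"
    by (auto simp: weak_compositions_def)
  then show ?case
    by simp
next
  case (Suc m)
  let ?c = "\<lambda>m l v. fps_const (fact l / (\<Prod>i=1..m. fact (v i)) :: 'a)"
  have "(\<Sum>i=1..Suc m. f i) ^ l = (f (Suc m) + (\<Sum>i=1..m. f i)) ^ l"
    by (simp add: add.commute)
  also have "\<dots> = (\<Sum>k\<le>l. of_nat (l choose k) * f (Suc m) ^ k * (\<Sum>i=1..m. f i) ^ (l - k))"
    by (rule binomial_ring)
  also have "\<dots> = (\<Sum>k\<le>l. \<Sum>v\<in>weak_compositions m (l - k).
      of_nat (l choose k) * f (Suc m) ^ k * (?c m (l - k) v * (\<Prod>i=1..m. f i ^ v i)))"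
    by (simp only: Suc.IH sum_distrib_left)
  also have "\<dots> = (\<Sum>(k, v)\<in>(SIGMA k:{..l}. weak_compositions m (l - k)).
      of_nat (l choose k) * f (Suc m) ^ k * (?c m (l - k) v * (\<Prod>i=1..m. f i ^ v i)))"
    by (rule sum.Sigma) (auto intro: finite_weak_compositions)
  also have "\<dots> = (\<Sum>(k, v)\<in>(SIGMA k:{..l}. weak_compositions m (l - k)).
      ?c (Suc m) l (v(Suc m := k)) * (\<Prod>i=1..Suc m. f i ^ (v(Suc m := k)) i))"
  proof (rule sum.cong[OF refl])
    fix x assume "x \<in> (SIGMA k:{..l}. weak_compositions m (l - k))"
    then obtain k v where x: "x = (k, v)" and k: "k \<le> l"
      by auto
    have "fps_const (of_nat (l choose k)) * ?c m (l - k) v = ?c (Suc m) l (v(Suc m := k))"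
      using k by (simp add: binomial_fact field_simps)
    moreover have "(\<Prod>i=1..Suc m. f i ^ (v(Suc m := k)) i) = f (Suc m) ^ k * (\<Prod>i=1..m. f i ^ v i)"
      by (simp add: mult.commute)
    ultimately have "of_nat (l choose k) * f (Suc m) ^ k * (?c m (l - k) v * (\<Prod>i=1..m. f i ^ v i)) =
        ?c (Suc m) l (v(Suc m := k)) * (\<Prod>i=1..Suc m. f i ^ (v(Suc m := k)) i)"
      by (metis (no_types, lifting) fps_of_nat mult.assoc mult.left_commute)
    then show "(case x of (k, v) \<Rightarrow>
          of_nat (l choose k) * f (Suc m) ^ k * (?c m (l - k) v * (\<Prod>i=1..m. f i ^ v i))) =
        (case x of (k, v) \<Rightarrow>
          ?c (Suc m) l (v(Suc m := k)) * (\<Prod>i=1..Suc m. f i ^ (v(Suc m := k)) i))"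
      by (simp only: x prod.case)
  qed
  also have "\<dots> = (\<Sum>v\<in>weak_compositions (Suc m) l. ?c (Suc m) l v * (\<Prod>i=1..Suc m. f i ^ v i))"
    by (subst sum.reindex_bij_betw[OF bij_betw_weak_compositions_Suc, symmetric])
      (simp only: case_prod_unfold)
  finally show ?case .
qed

lemma fps_const_exp_power:
  fixes a :: "'a :: field_char_0"
  shows "(fps_const a * fps_exp 1) ^ i = fps_const (a ^ i) * fps_exp (of_nat i)"
  by (simp add: power_mult_distrib fps_exp_power_mult)

lemma fps_const_minus_one_power: "(-1) ^ i = fps_const ((-1) ^ i :: 'a :: comm_ring_1)"
  by (metis fps_const_1_eq_1 fps_const_neg fps_const_power)

text \<open>Each multinomial term is a multiple of \<open>q ^ s\<close> with
  \<open>s = (\<Sum>i=1..m. i * v i)\<close>, hence of \<open>fps_exp s\<close>, whose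
  \<open>n\<close>-th coefficient is \<open>s ^ n / n!\<close>. At \<open>s = n = 0\<close> this
  agrees with the convention \<open>0 ^ 0 = 1\<close>.\<close>

lemma multiple_alternating_sum_egf:
  "fps_nth ((-1) ^ l * (\<Sum>i=1..m. (- (fps_const lam * fps_exp 1)) ^ i) ^ l) n =
     multiple_alternating_sum n l m lam / fact n"
proof -
  have "- (fps_const lam * fps_exp 1) = fps_const (- lam) * fps_exp 1"
    by (simp flip: fps_const_neg)
  then have q: "(- (fps_const lam * fps_exp 1)) ^ i = fps_const ((- lam) ^ i) * fps_exp (of_nat i)" for i
    by (simp only: fps_const_exp_power)
  have "(\<Prod>i=1..m. ((- (fps_const lam * fps_exp 1)) ^ i) ^ v i) =
      (- (fps_const lam * fps_exp 1)) ^ (\<Sum>i=1..m. i * v i)" for v :: "nat \<Rightarrow> nat"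
    by (simp only: power_sum power_mult)
  then have "(\<Sum>i=1..m. (- (fps_const lam * fps_exp 1)) ^ i) ^ l =
      (\<Sum>v\<in>weak_compositions m l. fps_const (fact l / (\<Prod>i=1..m. fact (v i)))
        * (fps_const ((- lam) ^ (\<Sum>i=1..m. i * v i)) * fps_exp (of_nat (\<Sum>i=1..m. i * v i))))"
    by (simp only: multinomial_fps q)
  then show ?thesis
    by (simp add: fps_const_minus_one_power multiple_alternating_sum_def fps_sum_nth
        sum_distrib_left sum_divide_distrib mult.assoc del: of_nat_sum of_nat_mult)
qed

lemma apostol_genocchi_base_geometric:
  fixes lam :: complex
  defines "q \<equiv> - (fps_const lam * fps_exp 1)"
  shows "fps_const 2 * fps_X * (\<Sum>i=1..m. q ^ i) = apostol_genocchi_base lam * (q * (1 - q ^ m))"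
proof -
  have "(1 - q) * (\<Sum>i=1..m. q ^ i) = q * (1 - q ^ m)"
  proof (induction m)
    case (Suc m)
    have "(1 - q) * (\<Sum>i=1..Suc m. q ^ i) = (1 - q) * (\<Sum>i=1..m. q ^ i) + (1 - q) * q ^ Suc m"
      by (simp add: distrib_left)
    also have "\<dots> = q * (1 - q ^ Suc m)"
      unfolding Suc.IH by (simp add: algebra_simps)
    finally show ?case .
  qed simp
  moreover have "fps_const 2 * fps_X = apostol_genocchi_base lam * (1 - q)"
    using apostol_genocchi_base_mult[of lam] by (simp add: q_def add.commute)
  ultimately show ?thesis
    by (simp add: mult.assoc)
qed

text \<open>The Cauchy product of \<open>B ^ a * fps_exp x\<close> and \<open>B ^ b\<close>. Only
  \<open>a + b\<close> survives, so the inner sums of the theorem, with \<open>a = j\<close> and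
  \<open>b = l - j\<close>, all involve the same power \<open>B ^ l\<close>.\<close>

lemma apostol_genocchi_convolution:
  "(\<Sum>k=0..N. of_nat (N choose k) * apostol_genocchi_poly k a x lam
      * apostol_genocchi_number (N - k) b lam) =
    fact N * fps_nth (apostol_genocchi_base lam ^ (a + b) * fps_exp x) N"
proof -
  let ?B = "apostol_genocchi_base lam"
  have "?B ^ (a + b) * fps_exp x = (?B ^ a * fps_exp x) * ?B ^ b"
    by (simp add: power_add mult_ac)
  then have "fact N * fps_nth (?B ^ (a + b) * fps_exp x) N =
      (\<Sum>k=0..N. fact N * (fps_nth (?B ^ a * fps_exp x) k * fps_nth (?B ^ b) (N - k)))"
    by (simp only: fps_mult_nth[of "?B ^ a * fps_exp x"] sum_distrib_left)
  also have "\<dots> = (\<Sum>k=0..N. of_nat (N choose k) * apostol_genocchi_poly k a x lam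
      * apostol_genocchi_number (N - k) b lam)"
    by (rule sum.cong)
      (simp_all add: apostol_genocchi_poly_def apostol_genocchi_number_def binomial_fact)
  finally show ?thesis ..
qed

theorem theorem2p7:
  fixes m n l :: nat and lam :: complex
  shows "multiple_alternating_sum n l m lam =
    1 / 2 ^ l * (\<Sum>j=0..l. of_nat (l choose j)
      * ((-1) ^ (j * (m + 1)) * lam ^ (m * j + l) / pochhammer (of_nat n + 1) l)
      * (\<Sum>k=0..n + l. of_nat ((n + l) choose k)
          * apostol_genocchi_poly k j (of_nat (m * j + l)) lam
          * apostol_genocchi_number (n + l - k) (l - j) lam))"
proof -
  define q where "q = - (fps_const lam * fps_exp 1)"
  define B where "B = apostol_genocchi_base lam"
  define c where "c j = of_nat (l choose j) * ((-1) ^ (j * (m + 1)) * lam ^ (m * j + l))" for j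
  \<comment> \<open>This quotient reconciles the \<open>n!\<close> of the generating function with
    the \<open>(n + l)!\<close> of the convolution.\<close>
  have poch: "pochhammer (of_nat n + 1 :: complex) l = fact (n + l) / fact n"
    using pochhammer_product'[of "1 :: complex" n l]
    by (simp add: add.commute flip: pochhammer_fact)
  have term_eq: "(-1) ^ l * q ^ l * (of_nat (l choose j) * (- (q ^ m)) ^ j) =
      fps_const (c j) * fps_exp (of_nat (m * j + l))" for j
  proof -
    \<comment> \<open>All powers are rewritten in terms of \<open>- q\<close>, which is
      \<open>lam\<close> times the exponential series; the extracted signs make up
      \<open>(-1) ^ (j * (m + 1))\<close>.\<close>
    have q: "q = - 1 * (- q)"
      by simp
    have "- (q ^ m) = (-1) ^ (m + 1) * (- q) ^ m"
      by (subst q, subst power_mult_distrib) simp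
    then have "(- (q ^ m)) ^ j = (-1) ^ (j * (m + 1)) * (- q) ^ (m * j)"
      by (simp only: power_mult_distrib mult.commute[of j] flip: power_mult)
    then have "(-1) ^ l * q ^ l * (- (q ^ m)) ^ j = (- q) ^ l * ((-1) ^ (j * (m + 1)) * (- q) ^ (m * j))"
      by (simp only: power_minus[of q l])
    also have "\<dots> = (-1) ^ (j * (m + 1)) * (- q) ^ (m * j + l)"
      by (simp add: power_add mult_ac)
    also have "\<dots> = fps_const ((-1) ^ (j * (m + 1)) * lam ^ (m * j + l))
        * fps_exp (of_nat (m * j + l))"
      by (simp add: q_def fps_const_exp_power fps_const_minus_one_power flip: mult.assoc
          del: of_nat_add of_nat_mult)
    finally have "(-1) ^ l * q ^ l * (of_nat (l choose j) * (- (q ^ m)) ^ j) =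
        of_nat (l choose j) * (fps_const ((-1) ^ (j * (m + 1)) * lam ^ (m * j + l))
          * fps_exp (of_nat (m * j + l)))"
      by (simp only: mult.left_commute)
    then show ?thesis
      by (simp only: c_def mult.assoc flip: fps_of_nat fps_const_mult)
  qed
  have geometric: "fps_const 2 * fps_X * (\<Sum>i=1..m. q ^ i) = B * (q * (1 - q ^ m))"
    unfolding q_def B_def by (rule apostol_genocchi_base_geometric)
  have "(fps_const 2 * fps_X) ^ l * ((-1) ^ l * (\<Sum>i=1..m. q ^ i) ^ l) =
      (-1) ^ l * (fps_const 2 * fps_X * (\<Sum>i=1..m. q ^ i)) ^ l"
    by (simp add: power_mult_distrib mult_ac)
  \<comment> \<open>The summand 1 stands second so that \<open>binomial_ring\<close> attaches the
    exponent \<open>j\<close> to \<open>- (q ^ m)\<close>.\<close>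
  also have "\<dots> = B ^ l * ((-1) ^ l * q ^ l * (- (q ^ m) + 1) ^ l)"
    by (simp only: geometric) (simp add: power_mult_distrib mult_ac)
  also have "\<dots> = (\<Sum>j\<le>l. fps_const (c j) * (B ^ l * fps_exp (of_nat (m * j + l))))"
    by (simp only: binomial_ring power_one mult_1_right sum_distrib_left term_eq)
      (simp only: mult.left_commute)
  finally have "fps_nth ((fps_const 2 * fps_X) ^ l * ((-1) ^ l * (\<Sum>i=1..m. q ^ i) ^ l)) (n + l) =
      (\<Sum>j\<le>l. c j * fps_nth (B ^ l * fps_exp (of_nat (m * j + l))) (n + l))"
    by (simp add: fps_sum_nth)
  \<comment> \<open>The factor \<open>fps_X ^ l\<close> shifts indices by \<open>l\<close>, so
    coefficient \<open>n + l\<close> here is \<open>2 ^ l\<close> times coefficient \<open>n\<close>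
    of the generating function.\<close>
  moreover have "fps_nth ((fps_const 2 * fps_X) ^ l * ((-1) ^ l * (\<Sum>i=1..m. q ^ i) ^ l)) (n + l) =
      2 ^ l * (multiple_alternating_sum n l m lam / fact n)"
    unfolding multiple_alternating_sum_egf[symmetric] q_def
    by (simp add: power_mult_distrib fps_X_power_mult_nth mult.assoc)
  ultimately have "multiple_alternating_sum n l m lam =
      1 / 2 ^ l * (\<Sum>j\<le>l. c j * (fact n * fps_nth (B ^ l * fps_exp (of_nat (m * j + l))) (n + l)))"
    by (simp add: field_simps flip: sum_distrib_left)
  also have "\<dots> = 1 / 2 ^ l * (\<Sum>j=0..l. of_nat (l choose j)
      * ((-1) ^ (j * (m + 1)) * lam ^ (m * j + l) / pochhammer (of_nat n + 1) l)
      * (\<Sum>k=0..n + l. of_nat ((n + l) choose k)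
          * apostol_genocchi_poly k j (of_nat (m * j + l)) lam
          * apostol_genocchi_number (n + l - k) (l - j) lam))"
    unfolding apostol_genocchi_convolution poch
    by (rule arg_cong2[of _ _ _ _ "(*)", OF refl sum.cong]) (auto simp: c_def B_def)
  finally show ?thesis .
qed

end
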